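(* Let $G$ be a finite group, $U$ a set, and $f_G$ a soft int-group in $G$ over $U$ whose support $f_G^{\ast}=\{x\in G: f_G(x)\neq\emptyset\}$ is nonempty. Then the number of distinct conjugates of $f_G$, i.e. the number of distinct functions in $\{f_{G^u}: u\in G\}$, where $f_{G^u}(x)=f_G(uxu^{-1})$ for all $x\in G$, is equal to the index of the normalizer $N(f_G)$ in $G$.
   Context: Let $P(U)$ be the power set of $U$. A soft int-group in $G$ over $U$ is a function $f_G:G\to P(U)$ such that $f_G(xy)\supseteq f_G(x)\cap f_G(y)$ and $f_G(x^{-1})=f_G(x)$ for all $x,y\in G$. The normalizer of $f_G$ in $G$ is $N(f_G)=\{x\in G: f_G(xy)=f_G(yx)\text{ for all }y\in G\}$, which is a subgroup of $G$. *)

theory Defs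
  imports "HOL-Algebra.Coset"
begin

text \<open>
  A soft set is a HOL function of which only the values on the carrier of \<open>G\<close> matter;
  conjugates are therefore restricted to the carrier, so that equality of two conjugates is
  equality as functions on \<open>G\<close>.
\<close>

definition soft_int_group ::
  "('a, 'm) monoid_scheme \<Rightarrow> 'b set \<Rightarrow> ('a \<Rightarrow> 'b set) \<Rightarrow> bool"
  where "soft_int_group G U f \<longleftrightarrow>
    f \<in> carrier G \<rightarrow> Pow U \<and>
    (\<forall>x\<in>carrier G. \<forall>y\<in>carrier G. f x \<inter> f y \<subseteq> f (x \<otimes>\<^bsub>G\<^esub> y)) \<and>
    (\<forall>x\<in>carrier G. f (inv\<^bsub>G\<^esub> x) = f x)"

definition soft_support :: "('a, 'm) monoid_scheme \<Rightarrow> ('a \<Rightarrow> 'b set) \<Rightarrow> 'a set"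
  where "soft_support G f = {x \<in> carrier G. f x \<noteq> {}}"

definition soft_normalizer :: "('a, 'm) monoid_scheme \<Rightarrow> ('a \<Rightarrow> 'b set) \<Rightarrow> 'a set"
  where "soft_normalizer G f =
    {x \<in> carrier G. \<forall>y\<in>carrier G. f (x \<otimes>\<^bsub>G\<^esub> y) = f (y \<otimes>\<^bsub>G\<^esub> x)}"

definition soft_conjugate ::
  "('a, 'm) monoid_scheme \<Rightarrow> ('a \<Rightarrow> 'b set) \<Rightarrow> 'a \<Rightarrow> 'a \<Rightarrow> 'b set"
  where "soft_conjugate G f u =
    (\<lambda>x\<in>carrier G. f (u \<otimes>\<^bsub>G\<^esub> x \<otimes>\<^bsub>G\<^esub> inv\<^bsub>G\<^esub> u))"

end

(* The conjugates by u and v agree iff u v^-1 lies in N(f): for z = v x u^-1, which runs over G as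
   x does, u x u^-1 = (u v^-1) z and v x v^-1 = z (u v^-1). This is also the condition for u and v
   to span the same right coset of N(f), so conjugates correspond to right cosets. *)
theory Submission
  imports Defs
begin

text \<open>Both functions have the same fibres on \<open>A\<close>, so sending \<open>f x\<close>
  to \<open>g x\<close> is a well-defined bijection between the images.\<close>

lemma card_image_eq_card_image:
  assumes "\<And>x y. x \<in> A \<Longrightarrow> y \<in> A \<Longrightarrow> f x = f y \<longleftrightarrow> g x = g y"
  shows "card (f ` A) = card (g ` A)"
proof (rule bij_betw_same_card)
  \<comment> \<open>The preimage picked by \<open>inv_into\<close> may differ from \<open>x\<close>,
    but it lies in the same fibre of \<open>f\<close>, hence of \<open>g\<close>.\<close>
  have h: "g (inv_into A f (f x)) = g x" if "x \<in> A" for x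
    by (metis assms f_inv_into_f imageI inv_into_into that)
  show "bij_betw (\<lambda>s. g (inv_into A f s)) (f ` A) (g ` A)"
    unfolding bij_betw_def inj_on_def by (auto simp: h assms image_image)
qed

context group
begin

lemma subgroup_soft_normalizer: "subgroup (soft_normalizer G f) G"
proof
  fix x y assume x: "x \<in> soft_normalizer G f" and y: "y \<in> soft_normalizer G f"
  have "f (x \<otimes> y \<otimes> z) = f (z \<otimes> (x \<otimes> y))" if z: "z \<in> carrier G" for z
  proof -
    \<comment> \<open>The factors rotate one at a time: first \<open>x\<close> moves to the far
      right, then \<open>y\<close>.\<close>
    have "f (x \<otimes> (y \<otimes> z)) = f (y \<otimes> z \<otimes> x)" "f (y \<otimes> (z \<otimes> x)) = f (z \<otimes> x \<otimes> y)"
      using x y z by (auto simp: soft_normalizer_def)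
    then show ?thesis
      using x y z by (simp add: soft_normalizer_def m_assoc)
  qed
  then show "x \<otimes> y \<in> soft_normalizer G f"
    using x y by (simp add: soft_normalizer_def)
next
  fix x assume x: "x \<in> soft_normalizer G f"
  then have [simp]: "x \<in> carrier G" by (simp add: soft_normalizer_def)
  have "f (inv x \<otimes> y) = f (y \<otimes> inv x)" if y: "y \<in> carrier G" for y
  proof -
    \<comment> \<open>Flanking \<open>y\<close> by \<open>inv x\<close> on both sides lets
      \<open>x\<close> cancel one of the two on either side of the equation.\<close>
    have "f (x \<otimes> (inv x \<otimes> y \<otimes> inv x)) = f (inv x \<otimes> y \<otimes> inv x \<otimes> x)"
      using x y by (simp add: soft_normalizer_def)
    moreover have "x \<otimes> (inv x \<otimes> y \<otimes> inv x) = y \<otimes> inv x"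
      using y by (simp flip: m_assoc)
    moreover have "inv x \<otimes> y \<otimes> inv x \<otimes> x = inv x \<otimes> y"
      using y by (simp add: m_assoc)
    ultimately show ?thesis by simp
  qed
  then show "inv x \<in> soft_normalizer G f"
    by (simp add: soft_normalizer_def)
qed (auto simp: soft_normalizer_def)

lemma soft_conjugate_eq_iff:
  assumes u: "u \<in> carrier G" and v: "v \<in> carrier G"
  shows "soft_conjugate G f u = soft_conjugate G f v \<longleftrightarrow> u \<otimes> inv v \<in> soft_normalizer G f"
proof -
  \<comment> \<open>Outside the carrier both conjugates are \<open>undefined\<close>, so only values
    on the carrier are compared.\<close>
  have conj_eq_iff: "soft_conjugate G f u = soft_conjugate G f v \<longleftrightarrow>
      (\<forall>x\<in>carrier G. f (u \<otimes> x \<otimes> inv u) = f (v \<otimes> x \<otimes> inv v))"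
    by (auto simp: soft_conjugate_def restrict_def fun_eq_iff)
  have cancel: "inv v \<otimes> (v \<otimes> x) = x" "v \<otimes> (inv v \<otimes> x) = x" "inv u \<otimes> (u \<otimes> x) = x"
    if "x \<in> carrier G" for x
    using u v that by (simp_all flip: m_assoc)
  have left: "u \<otimes> inv v \<otimes> (v \<otimes> x \<otimes> inv u) = u \<otimes> x \<otimes> inv u"
    and right: "v \<otimes> x \<otimes> inv u \<otimes> (u \<otimes> inv v) = v \<otimes> x \<otimes> inv v" if "x \<in> carrier G" for x
    using u v that by (simp_all add: m_assoc cancel)
  \<comment> \<open>Solving \<open>z = v \<otimes> x \<otimes> inv u\<close> for \<open>x\<close>
    gives this witness, which justifies replacing the quantifier over \<open>z\<close> by one over
    \<open>x\<close>.\<close>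
  have surj: "z = v \<otimes> (inv v \<otimes> z \<otimes> u) \<otimes> inv u" "inv v \<otimes> z \<otimes> u \<in> carrier G"
    if "z \<in> carrier G" for z
    using u v that by (simp_all add: m_assoc cancel)
  have "u \<otimes> inv v \<in> soft_normalizer G f \<longleftrightarrow>
      (\<forall>z\<in>carrier G. f (u \<otimes> inv v \<otimes> z) = f (z \<otimes> (u \<otimes> inv v)))"
    using u v by (simp add: soft_normalizer_def)
  also have "\<dots> \<longleftrightarrow> (\<forall>x\<in>carrier G. f (u \<otimes> inv v \<otimes> (v \<otimes> x \<otimes> inv u)) = f (v \<otimes> x \<otimes> inv u \<otimes> (u \<otimes> inv v)))"
  proof (intro iffI ballI)
    fix z
    assume *: "\<forall>x\<in>carrier G. f (u \<otimes> inv v \<otimes> (v \<otimes> x \<otimes> inv u)) = f (v \<otimes> x \<otimes> inv u \<otimes> (u \<otimes> inv v))"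
      and z: "z \<in> carrier G"
    show "f (u \<otimes> inv v \<otimes> z) = f (z \<otimes> (u \<otimes> inv v))"
      using bspec[OF * surj(2)[OF z]] by (simp only: surj(1)[OF z, symmetric])
  qed (use u v in simp)
  finally show ?thesis
    by (simp add: conj_eq_iff left right)
qed

text \<open>The right-hand condition says that \<open>u\<close> lies in \<open>H #> v\<close>. A
  coset is determined by any of its elements, and \<open>u\<close> lies in
  \<open>H #> u\<close>.\<close>

lemma r_coset_eq_iff:
  assumes H: "subgroup H G" and u: "u \<in> carrier G" and v: "v \<in> carrier G"
  shows "H #> u = H #> v \<longleftrightarrow> u \<otimes> inv v \<in> H"
  using subgroup.rcos_module[OF H is_group v u] repr_independence[OF _ v H] rcos_self[OF u H]
  by auto

end

theorem theorem3p29: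
  fixes G :: "('a, 'm) monoid_scheme" and U :: "'b set" and f :: "'a \<Rightarrow> 'b set"
  assumes "group G"
    and "finite (carrier G)"
    and "soft_int_group G U f"
    and "soft_support G f \<noteq> {}"
  shows "card {soft_conjugate G f u | u. u \<in> carrier G} = card (rcosets\<^bsub>G\<^esub> (soft_normalizer G f))"
proof -
  interpret group G by fact
  \<comment> \<open>Conjugates and cosets have the same fibres over the carrier, both described by
    \<open>u \<otimes> inv v\<close> lying in the normalizer.\<close>
  have "card (soft_conjugate G f ` carrier G) = card ((\<lambda>u. soft_normalizer G f #>\<^bsub>G\<^esub> u) ` carrier G)"
    by (rule card_image_eq_card_image)
      (simp add: soft_conjugate_eq_iff r_coset_eq_iff subgroup_soft_normalizer)
  moreover have "rcosets\<^bsub>G\<^esub> (soft_normalizer G f) = (\<lambda>u. soft_normalizer G f #>\<^bsub>G\<^esub> u) ` carrier G"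
    by (auto simp: RCOSETS_def)
  ultimately show ?thesis
    by (simp add: Setcompr_eq_image)
qed

end
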